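(* Let $G=(V,E)$ be a finite directed graph (parallel edges allowed) with $n=|V|\ge 1$ vertices which is Eulerian in the sense that $d_{\mathrm{in}}(v)=d_{\mathrm{out}}(v)$ for all $v\in V$. Then \[ w_1^2\le n\cdot w_2, \] or, in the form of a ratio inequality when $w_1>0$, \[ \frac{w_1}{w_0}\le\frac{w_2}{w_1}. \]
   Context: For a directed (multi-)graph $G=(V,E)$, $d_{\mathrm{in}}(v)$ and $d_{\mathrm{out}}(v)$ denote the in-degree and out-degree of the vertex $v$ (counting parallel edges with multiplicity). A $k$-step walk (walk of length $k$) is an alternating sequence $(v_0,e_1,v_1,\ldots,v_{k-1},e_k,v_k)$ of vertices $v_i\in V$ and edges $e_i\in E$ such that each $e_i$ is an edge directed from $v_{i-1}$ to $v_i$; vertices and edges may be repeated. $w_k$ denotes the total number of $k$-step walks in $G$; in particular $w_0=n$ and $w_1=|E|$. Here "Eulerian" means only that in-degree equals out-degree at every vertex; connectedness is not required. *)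

theory Defs
  imports Complex_Main "Graph_Theory.Arc_Walk"
begin

text \<open>
  A walk is given by its start vertex, its list of arcs and its end vertex; the intermediate
  vertices are the tails and heads of the arcs. Parallel arcs are distinct, so walks through
  different parallel arcs are counted separately. The end vertices matter only for \<open>k = 0\<close>,
  where they tell the empty walks at different vertices apart.
\<close>

definition walks :: "('a, 'b) pre_digraph \<Rightarrow> nat \<Rightarrow> ('a \<times> 'b awalk \<times> 'a) set" where
  "walks G k = {(u, p, v). pre_digraph.awalk G u p v \<and> length p = k}"

definition num_walks :: "('a, 'b) pre_digraph \<Rightarrow> nat \<Rightarrow> nat" where
  "num_walks G k = card (walks G k)"

lemma num_walks_0: "num_walks G 0 = card (verts G)"
proof -
  have "walks G 0 = (\<lambda>v. (v, [], v)) ` verts G"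
    by (auto simp: walks_def pre_digraph.awalk_def pre_digraph.cas.simps)
  then show ?thesis
    by (simp add: num_walks_def card_image inj_on_def)
qed

lemma num_walks_1:
  assumes "wf_digraph G"
  shows "num_walks G 1 = card (arcs G)"
proof -
  have "walks G 1 = (\<lambda>e. (tail G e, [e], head G e)) ` arcs G"
    using wf_digraph.tail_in_verts[OF assms]
    by (auto simp: walks_def pre_digraph.awalk_def pre_digraph.cas.simps length_Suc_conv)
  then show ?thesis
    by (simp add: num_walks_def card_image inj_on_def)
qed

end

theory Submission
  imports Defs "HOL-Analysis.Convex"
begin

text \<open>
  In an Eulerian graph the number of 1-step walks is the sum of the out-degrees, and counting
  2-step walks by their middle vertex gives the sum of the squared out-degrees. The inequality is
  then Cauchy-Schwarz against the constant function 1.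
\<close>

text \<open>Each arc has exactly one tail, and this is a vertex, so the sets
  \<open>out_arcs G v\<close> partition \<open>arcs G\<close>.\<close>

lemma (in fin_digraph) card_arcs_eq_sum_out_degree: "card (arcs G) = (\<Sum>v\<in>verts G. out_degree G v)"
proof -
  have "arcs G = (\<Union>v\<in>verts G. out_arcs G v)"
    by (auto simp: out_arcs_def)
  moreover have "card (\<Union>v\<in>verts G. out_arcs G v) = (\<Sum>v\<in>verts G. card (out_arcs G v))"
    by (rule card_UN_disjoint) (auto simp: out_arcs_def)
  ultimately show ?thesis
    by (simp add: out_degree_def)
qed

text \<open>Once the middle vertex is fixed, the arc into it and the arc out of it can be chosen
  independently.\<close>

lemma (in fin_digraph) num_walks_2: "num_walks G 2 = (\<Sum>v\<in>verts G. in_degree G v * out_degree G v)"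
proof -
  let ?S = "SIGMA v:verts G. in_arcs G v \<times> out_arcs G v"
  have "walks G 2 = (\<lambda>(v, e, f). (tail G e, [e, f], head G f)) ` ?S"
  proof (intro set_eqI iffI)
    fix x assume "x \<in> walks G 2"
    then obtain e f where "x = (tail G e, [e, f], head G f)" "e \<in> arcs G" "f \<in> arcs G" "head G e = tail G f"
      by (auto simp: walks_def awalk_def numeral_2_eq_2 length_Suc_conv)
    then show "x \<in> (\<lambda>(v, e, f). (tail G e, [e, f], head G f)) ` ?S"
      by (intro image_eqI[of _ _ "(tail G f, e, f)"]) auto
  next
    fix x assume "x \<in> (\<lambda>(v, e, f). (tail G e, [e, f], head G f)) ` ?S"
    then show "x \<in> walks G 2"
      by (auto simp: walks_def awalk_def)
  qed
  \<comment> \<open>The arc list returns \<open>e\<close> and \<open>f\<close>, and \<open>v\<close>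
    is then the head of \<open>e\<close>.\<close>
  moreover have "inj_on (\<lambda>(v, e, f). (tail G e, [e, f], head G f)) ?S"
    by (auto simp: inj_on_def)
  ultimately have "num_walks G 2 = card ?S"
    by (simp add: num_walks_def card_image)
  also have "\<dots> = (\<Sum>v\<in>verts G. in_degree G v * out_degree G v)"
    by (subst card_SigmaI) (auto simp: card_cartesian_product in_degree_def out_degree_def)
  finally show ?thesis .
qed

theorem mainTheorem3:
  fixes G :: "('a, 'b) pre_digraph"
  assumes "fin_digraph G"
    and "card (verts G) \<ge> 1"
    and "\<forall>v\<in>verts G. in_degree G v = out_degree G v"
  shows "(num_walks G 1)\<^sup>2 \<le> card (verts G) * num_walks G 2 \<and>
    (num_walks G 1 > 0 \<longrightarrow>
      real (num_walks G 1) / real (num_walks G 0) \<le> real (num_walks G 2) / real (num_walks G 1))"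
proof -
  interpret fin_digraph G by fact
  have w1: "num_walks G 1 = (\<Sum>v\<in>verts G. out_degree G v)"
    using num_walks_1[OF wf_digraph_axioms] card_arcs_eq_sum_out_degree by simp
  \<comment> \<open>The Eulerian hypothesis enters here: it turns each product of degrees into a
    square.\<close>
  have w2: "num_walks G 2 = (\<Sum>v\<in>verts G. (out_degree G v)\<^sup>2)"
    using assms(3) by (simp add: num_walks_2 power2_eq_square)
  have real_ineq: "(real (num_walks G 1))\<^sup>2 \<le> real (card (verts G)) * real (num_walks G 2)"
    using sum_squared_le_sum_of_squares[of "\<lambda>v. real (out_degree G v)" "verts G"]
    \<comment> \<open>Keeping \<open>1\<close> from becoming \<open>Suc 0\<close> lets
      \<open>w1\<close> match.\<close>
    by (simp add: w1 w2 mult.commute del: One_nat_def)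
  then have "(num_walks G 1)\<^sup>2 \<le> card (verts G) * num_walks G 2"
    by (metis of_nat_le_iff of_nat_mult of_nat_power)
  \<comment> \<open>Both denominators are positive, \<open>num_walks G 0\<close> because there is a
    vertex, so cross-multiplying gives \<open>real_ineq\<close>.\<close>
  moreover have "real (num_walks G 1) / real (num_walks G 0) \<le> real (num_walks G 2) / real (num_walks G 1)"
    if "num_walks G 1 > 0"
    using that assms(2) real_ineq
    by (simp add: num_walks_0 divide_simps power2_eq_square mult.commute)
  ultimately show ?thesis
    by blast
qed

end
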